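(* Let $n\ge 7$. If $n$ is odd, put $k=\binom{n-7}{(n-7)/2}-1$; if $n$ is even, put $k=2\binom{n-8}{(n-8)/2}-1$ (where $\binom{0}{0}=1$). Then $h(n,k)$ does not exist: for every positive integer $N$ there is a set $\mathcal X$ of at least $N$ points in the plane in general position such that every convex $n$-gon with vertices in $\mathcal X$ contains more than $k$ points of $\mathcal X$ in its interior.
   Context: A finite planar point set is in general position if no three of its points are collinear. For integers $n\ge3$, $k\ge0$, $h(n,k)$ is the least positive integer (if it exists) such that every planar set $\mathcal X$ in general position with at least $h(n,k)$ points contains a convex $n$-gon $C$ with vertices in $\mathcal X$ whose interior contains at most $k$ points of $\mathcal X$. *)

theory Defs
  imports "HOL-Analysis.Analysis"
begin

type_synonym point = "real^2"

definition general_position :: "point set \<Rightarrow> bool" where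
  "general_position X \<longleftrightarrow> (\<forall>a\<in>X. \<forall>b\<in>X. \<forall>c\<in>X.
      a \<noteq> b \<and> a \<noteq> c \<and> b \<noteq> c \<longrightarrow> \<not> collinear {a, b, c})"

definition convex_ngon :: "nat \<Rightarrow> point set \<Rightarrow> bool" where
  "convex_ngon n C \<longleftrightarrow> finite C \<and> card C = n \<and>
      (\<forall>p\<in>C. p \<notin> convex hull (C - {p}))"

definition interior_count :: "point set \<Rightarrow> point set \<Rightarrow> nat" where
  "interior_count X C = card {x \<in> X. x \<in> interior (convex hull C)}"

definition kval :: "nat \<Rightarrow> nat" where
  "kval n = (if odd n then ((n - 7) choose ((n - 7) div 2)) - 1
             else 2 * ((n - 8) choose ((n - 8) div 2)) - 1)"

end

theory Submission
  imports Defs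
begin

text \<open>Replace every point of a large Horton set by a tiny, almost vertical copy of an Erdos-Szekeres
  set with \<open>2m choose m\<close> points and no cup or cap of more than \<open>m + 1\<close> points. A convex polygon that
  meets \<open>c \<ge> 2\<close> clusters has at most \<open>m + 1\<close> vertices in each of the leftmost and the rightmost cluster
  and at most one in every other, so a polygon with \<open>2m + 6 + j\<close> vertices meets at least \<open>6 + j\<close>
  clusters. The corresponding points of the Horton set are in convex position, and \<open>6 + j\<close> such
  points surround at least \<open>j\<close> points of the Horton set, hence \<open>j\<close> complete clusters. For odd \<open>n\<close> one
  takes \<open>j = 1\<close>, for even \<open>n\<close> one takes \<open>j = 2\<close>.\<close>

text \<open>The number 6 is 3 + 3. A subset of a Horton set in convex position that meets both
  halves of a splitting consists of a lower cup and an upper cap, because one vertex in the other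
  half traps any vertex that bulges the wrong way. A cup of c points has at least c - 3 points of
  the set above its chords, in its own half or inside the polygon's reach across a finer splitting;
  one vertex far above it puts all of these inside the polygon. Caps are symmetric. Near-vertical
  clusters keep polygons under control: a line through two points of one cluster separates the other
  clusters just as a vertical line does. Everything is phrased by strict signs of
  \<open>orient\<close>, which a small perturbation preserves; hence a triangle of the Horton set
  around a point yields, whatever vertices represent its corners, a triangle around the whole
  cluster of that point. As n = 2m + 6 + j, the parity of n fixes that of j, and 1 and 2 are the
  least positive choices. For n = 7 and n = 8 the clusters are single points.\<close>

section \<open>Orientations, triangles, cups and caps\<close>

definition orient :: "point \<Rightarrow> point \<Rightarrow> point \<Rightarrow> real" where
  "orient a b c = (b$1 - a$1) * (c$2 - a$2) - (b$2 - a$2) * (c$1 - a$1)"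

text \<open>The three signs add up to \<open>orient a b c > 0\<close>, so the corners are listed
  counterclockwise and \<open>p\<close> is strictly inside.\<close>

definition in_triangle :: "point \<Rightarrow> point \<Rightarrow> point \<Rightarrow> point \<Rightarrow> bool" where
  "in_triangle p a b c \<longleftrightarrow> orient a b p > 0 \<and> orient b c p > 0 \<and> orient c a p > 0"

text \<open>Only strict containment in a triangle is excluded. This follows from
  \<open>convex_ngon\<close>, and being a matter of orientation signs it can be carried from the
  clusters back to the Horton set.\<close>

definition convex_position :: "point set \<Rightarrow> bool" where
  "convex_position K \<longleftrightarrow> (\<forall>p\<in>K. \<forall>a\<in>K. \<forall>b\<in>K. \<forall>c\<in>K. \<not> in_triangle p a b c)"

definition cup :: "point set \<Rightarrow> bool" where
  "cup K \<longleftrightarrow> (\<forall>a\<in>K. \<forall>b\<in>K. \<forall>c\<in>K. a$1 < b$1 \<longrightarrow> b$1 < c$1 \<longrightarrow> orient a b c > 0)"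

definition cap :: "point set \<Rightarrow> bool" where
  "cap K \<longleftrightarrow> (\<forall>a\<in>K. \<forall>b\<in>K. \<forall>c\<in>K. a$1 < b$1 \<longrightarrow> b$1 < c$1 \<longrightarrow> orient a b c < 0)"

definition simple_position :: "point set \<Rightarrow> bool" where
  "simple_position S \<longleftrightarrow> inj_on (\<lambda>p. p$1) S \<and>
     (\<forall>a\<in>S. \<forall>b\<in>S. \<forall>c\<in>S. a \<noteq> b \<longrightarrow> a \<noteq> c \<longrightarrow> b \<noteq> c \<longrightarrow> orient a b c \<noteq> 0)"

lemma orient_rotate: "orient a b c = orient b c a"
  by (simp add: orient_def algebra_simps)

lemma orient_swap: "orient b a c = - orient a b c"
  by (simp add: orient_def algebra_simps)

lemma orient_degenerate [simp]: "orient a a b = 0" "orient a b a = 0" "orient b a a = 0"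
  by (simp_all add: orient_def algebra_simps)

lemma point_eq_iff: "p = q \<longleftrightarrow> p$1 = q$1 \<and> p$2 = q$2" for p q :: point
  by (simp add: vec_eq_iff forall_2)

text \<open>A mixed triple has two points in one set and one in the other; rotation and swapping
  reduce it to a pair ordered by first coordinate, which is the form in which the constructions
  supply signs.\<close>

lemma simple_position_Un:
  assumes "simple_position A" "simple_position B"
    and disj: "\<And>a b. a \<in> A \<Longrightarrow> b \<in> B \<Longrightarrow> a$1 \<noteq> b$1"
    and A: "\<And>a a' b. a \<in> A \<Longrightarrow> a' \<in> A \<Longrightarrow> b \<in> B \<Longrightarrow> a$1 < a'$1 \<Longrightarrow> orient a a' b \<noteq> 0"
    and B: "\<And>b b' a. b \<in> B \<Longrightarrow> b' \<in> B \<Longrightarrow> a \<in> A \<Longrightarrow> b$1 < b'$1 \<Longrightarrow> orient b b' a \<noteq> 0"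
  shows "simple_position (A \<union> B)"
proof -
  have inj: "inj_on (\<lambda>p. p$1) (A \<union> B)"
    using assms(1,2) disj by (auto simp: simple_position_def inj_on_Un)
  have A': "orient a a' b \<noteq> 0" if "a \<in> A" "a' \<in> A" "b \<in> B" "a \<noteq> a'" for a a' b
  proof -
    have "a$1 \<noteq> a'$1" using inj that by (meson UnI1 inj_onD)
    then show ?thesis
      using A[of a a' b] A[of a' a b] that orient_swap[of a a' b] by linarith
  qed
  have B': "orient b b' a \<noteq> 0" if "b \<in> B" "b' \<in> B" "a \<in> A" "b \<noteq> b'" for b b' a
  proof -
    have "b$1 \<noteq> b'$1" using inj that by (meson UnI2 inj_onD)
    then show ?thesis
      using B[of b b' a] B[of b' b a] that orient_swap[of b b' a] by linarith
  qed
  show ?thesis unfolding simple_position_def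
  proof (intro conjI ballI impI inj)
    fix a b c assume "a \<in> A \<union> B" "b \<in> A \<union> B" "c \<in> A \<union> B" "a \<noteq> b" "a \<noteq> c" "b \<noteq> c"
    then show "orient a b c \<noteq> 0"
      using assms(1,2) A'[of a b c] A'[of b c a] A'[of c a b] B'[of a b c] B'[of b c a] B'[of c a b]
        orient_rotate[of a b c] orient_rotate[of b c a] unfolding simple_position_def
      by (metis Un_iff)
  qed
qed

lemma collinear_imp_orient_0:
  assumes "collinear {a, b, c}" shows "orient a b c = 0"
proof -
  obtain u where "\<And>x y. x \<in> {a,b,c} \<Longrightarrow> y \<in> {a,b,c} \<Longrightarrow> \<exists>k. x - y = k *\<^sub>R u"
    using assms unfolding collinear_def by blast
  then obtain k l where k: "b - a = k *\<^sub>R u" and l: "c - a = l *\<^sub>R u"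
    by (metis insertCI)
  have "b$1 - a$1 = k * u$1" "b$2 - a$2 = k * u$2" "c$1 - a$1 = l * u$1" "c$2 - a$2 = l * u$2"
    using arg_cong[OF k, of "\<lambda>v. v$1"] arg_cong[OF k, of "\<lambda>v. v$2"]
      arg_cong[OF l, of "\<lambda>v. v$1"] arg_cong[OF l, of "\<lambda>v. v$2"] by auto
  then show ?thesis by (simp add: orient_def)
qed

lemma in_triangle_imp_hull:
  assumes "in_triangle p a b c" shows "p \<in> convex hull {a, b, c}"
proof -
  define s where "s = orient a b c"
  \<comment> \<open>Up to the factor \<open>s\<close> these areas are the barycentric coordinates of
    \<open>p\<close>.\<close>
  define u v w where "u = orient b c p" "v = orient c a p" "w = orient a b p"
  have pos: "u > 0" "v > 0" "w > 0" using assms by (auto simp: in_triangle_def u_v_w_def)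
  have s: "s = u + v + w" by (simp add: s_def u_v_w_def orient_def algebra_simps)
  have "s * p$1 = u * a$1 + v * b$1 + w * c$1" "s * p$2 = u * a$2 + v * b$2 + w * c$2"
    by (simp_all add: s_def u_v_w_def orient_def algebra_simps)
  then have "p$1 = (u/s) * a$1 + (v/s) * b$1 + (w/s) * c$1"
     "p$2 = (u/s) * a$2 + (v/s) * b$2 + (w/s) * c$2"
    using pos s by (simp_all add: add_divide_distrib[symmetric] nonzero_eq_divide_eq mult.commute)
  then have "p = (u/s) *\<^sub>R a + (v/s) *\<^sub>R b + (w/s) *\<^sub>R c"
    by (simp add: point_eq_iff)
  moreover have "u/s + v/s + w/s = 1" using pos s by (simp add: add_divide_distrib[symmetric])
  moreover have "0 \<le> u/s" "0 \<le> v/s" "0 \<le> w/s" using pos s by auto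
  ultimately show ?thesis unfolding convex_hull_3 by blast
qed

lemma in_triangle_imp_interior:
  assumes "in_triangle p a b c" shows "p \<in> interior (convex hull {a, b, c})"
proof (rule interiorI)
  show "open {q. in_triangle q a b c}"
    unfolding in_triangle_def orient_def
    by (intro open_Collect_conj open_Collect_less continuous_intros)
qed (use assms in_triangle_imp_hull in auto)

lemma convex_ngon_imp_convex_position:
  assumes "convex_ngon n C" shows "convex_position C"
  unfolding convex_position_def
proof (intro ballI notI)
  fix p a b c assume mem: "p \<in> C" "a \<in> C" "b \<in> C" "c \<in> C" and tri: "in_triangle p a b c"
  from tri have "p \<noteq> a" "p \<noteq> b" "p \<noteq> c" by (auto simp: in_triangle_def)
  then have "{a, b, c} \<subseteq> C - {p}" using mem by auto
  then have "p \<in> convex hull (C - {p})"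
    using in_triangle_imp_hull[OF tri] hull_mono by blast
  then show False using assms mem(1) by (auto simp: convex_ngon_def)
qed

section \<open>Horton sets\<close>

text \<open>Interleaving of the halves is stated through separating points, the form in which it is
  counted later. The conditions on \<open>L\<close> and \<open>U\<close> mirror each other, so a
  reflection in the horizontal axis just exchanges the halves.\<close>

inductive horton :: "point set \<Rightarrow> bool" where
  single: "horton {p}"
| join: "horton (L \<union> U)" if "horton L" "horton U"
    "\<And>a b. a \<in> L \<Longrightarrow> b \<in> U \<Longrightarrow> a$1 \<noteq> b$1"
    "\<And>a b. a \<in> L \<Longrightarrow> b \<in> L \<Longrightarrow> a$1 < b$1 \<Longrightarrow> \<exists>u\<in>U. a$1 < u$1 \<and> u$1 < b$1"
    "\<And>a b. a \<in> U \<Longrightarrow> b \<in> U \<Longrightarrow> a$1 < b$1 \<Longrightarrow> \<exists>u\<in>L. a$1 < u$1 \<and> u$1 < b$1"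
    "\<And>a b u. a \<in> L \<Longrightarrow> b \<in> L \<Longrightarrow> u \<in> U \<Longrightarrow> a$1 < b$1 \<Longrightarrow> orient a b u > 0"
    "\<And>a b l. a \<in> U \<Longrightarrow> b \<in> U \<Longrightarrow> l \<in> L \<Longrightarrow> a$1 < b$1 \<Longrightarrow> orient a b l < 0"

lemma horton_finite: "horton S \<Longrightarrow> finite S"
  by (induction rule: horton.induct) auto

lemma horton_simple_position: "horton S \<Longrightarrow> simple_position S"
proof (induction rule: horton.induct)
  case (single p)
  then show ?case by (auto simp: simple_position_def)
next
  case (join L U)
  show ?case
  proof (rule simple_position_Un[OF join.IH join.hyps(3)])
    show "orient a a' b \<noteq> 0" if "a \<in> L" "a' \<in> L" "b \<in> U" "a$1 < a'$1" for a a' b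
      using join.hyps(6)[OF that] by simp
    show "orient b b' a \<noteq> 0" if "b \<in> U" "b' \<in> U" "a \<in> L" "b$1 < b'$1" for b b' a
      using join.hyps(7)[OF that] by simp
  qed
qed

definition reflect :: "point \<Rightarrow> point" where
  "reflect p = vector [p$1, - p$2]"

lemma reflect_nth [simp]: "reflect p $ 1 = p $ 1" "reflect p $ 2 = - p $ 2"
  by (simp_all add: reflect_def)

lemma reflect_reflect [simp]: "reflect (reflect p) = p"
  by (simp add: point_eq_iff)

lemma orient_reflect [simp]: "orient (reflect a) (reflect b) (reflect c) = - orient a b c"
  by (simp add: orient_def algebra_simps)

lemma horton_reflect: "horton S \<Longrightarrow> horton (reflect ` S)"
proof (induction rule: horton.induct)
  case (single p)
  then show ?case by (simp add: horton.single)
next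
  case (join L U)
  have "horton (reflect ` U \<union> reflect ` L)"
    by (rule horton.join) (use join in \<open>auto, metis\<close>)
  then show ?case by (simp add: image_Un Un_commute)
qed

definition stretch :: "real \<Rightarrow> real \<Rightarrow> point \<Rightarrow> point" where
  "stretch s t p = vector [2 * p$1 + s, p$2 + t]"

lemma stretch_nth [simp]: "stretch s t p $ 1 = 2 * p $ 1 + s" "stretch s t p $ 2 = p $ 2 + t"
  by (simp_all add: stretch_def)

lemma orient_stretch [simp]:
  "orient (stretch s t a) (stretch s t b) (stretch s t c) = 2 * orient a b c"
  by (simp add: orient_def algebra_simps)

lemma horton_stretch: "horton S \<Longrightarrow> horton (stretch s t ` S)"
proof (induction rule: horton.induct)
  case (single p)
  then show ?case by (simp add: horton.single)
next
  case (join L U)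
  have "horton (stretch s t ` L \<union> stretch s t ` U)"
    by (rule horton.join) (use join in auto)
  then show ?case by (simp add: image_Un)
qed

lemma eventually_affine_pos:
  assumes "(c::real) > 0" shows "\<forall>\<^sub>F t in at_top. c * t + d > 0"
  using eventually_gt_at_top[of "- d / c"]
  by eventually_elim (use assms in \<open>simp add: field_simps\<close>)

text \<open>Knowing the first coordinates to be exactly 0, ..., 2^d - 1 makes the induction work:
  two copies are stretched to the even and the odd positions, and the odd copy is lifted.\<close>

lemma horton_exists: "\<exists>S. horton S \<and> (\<lambda>p. p$1) ` S = real ` {..<2^d}"
proof (induction d)
  case 0
  have "(\<lambda>p. p$1) ` {0::point} = real ` {..<2^0}" by auto
  then show ?case using horton.single by blast
next
  case (Suc d)
  then obtain S where S: "horton S" and x: "(\<lambda>p. p$1) ` S = real ` {..<2^d}" by blast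
  note fin = horton_finite[OF S]
  have "\<forall>\<^sub>F t in at_top. \<forall>a\<in>S. \<forall>b\<in>S. \<forall>c\<in>S. a$1 < b$1 \<longrightarrow>
      orient (stretch 0 0 a) (stretch 0 0 b) (stretch 1 t c) > 0 \<and>
      orient (stretch 1 t a) (stretch 1 t b) (stretch 0 0 c) < 0"
  proof (intro eventually_ball_finite fin ballI)
    fix a b c assume "a \<in> S" "b \<in> S" "c \<in> S"
    show "\<forall>\<^sub>F t in at_top. a$1 < b$1 \<longrightarrow>
      orient (stretch 0 0 a) (stretch 0 0 b) (stretch 1 t c) > 0 \<and>
      orient (stretch 1 t a) (stretch 1 t b) (stretch 0 0 c) < 0"
    proof (cases "a$1 < b$1")
      case True
      then have c: "2 * (b$1 - a$1) > 0" by simp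
      define d1 where "d1 = orient (stretch 0 0 a) (stretch 0 0 b) (stretch 1 0 c)"
      define d2 where "d2 = - orient (stretch 1 0 a) (stretch 1 0 b) (stretch 0 0 c)"
      \<comment> \<open>Both signs are governed by the same positive slope in the lift
        \<open>t\<close>, so each holds for all large \<open>t\<close>; finitely many triples then
        share one \<open>t\<close>.\<close>
      have e: "orient (stretch 0 0 a) (stretch 0 0 b) (stretch 1 t c) =
          2 * (b$1 - a$1) * t + d1"
        "orient (stretch 1 t a) (stretch 1 t b) (stretch 0 0 c) =
         - (2 * (b$1 - a$1) * t + d2)" for t
        by (simp_all add: d1_def d2_def orient_def algebra_simps)
      show ?thesis unfolding e neg_less_0_iff_less
        using eventually_conj[OF eventually_affine_pos[OF c] eventually_affine_pos[OF c]]
        by (auto elim: eventually_mono)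
    qed simp
  qed
  then obtain t where t: "\<And>a b c. a \<in> S \<Longrightarrow> b \<in> S \<Longrightarrow> c \<in> S \<Longrightarrow> a$1 < b$1 \<Longrightarrow>
      orient (stretch 0 0 a) (stretch 0 0 b) (stretch 1 t c) > 0 \<and>
      orient (stretch 1 t a) (stretch 1 t b) (stretch 0 0 c) < 0"
    using eventually_happens'[OF trivial_limit_at_top_linorder] by blast
  have int: "\<exists>i<2^d. p$1 = real i" if "p \<in> S" for p
  proof -
    have "p$1 \<in> (\<lambda>p. p$1) ` S" using that by blast
    then show ?thesis unfolding x by blast
  qed
  have int': "\<exists>p\<in>S. p$1 = real i" if "i < 2^d" for i
  proof -
    have "real i \<in> (\<lambda>p. p$1) ` S" unfolding x using that by blast
    then show ?thesis by auto
  qed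
  have "horton (stretch 0 0 ` S \<union> stretch 1 t ` S)"
  proof (rule horton.join)
    fix a b assume "a \<in> stretch 0 0 ` S" "b \<in> stretch 1 t ` S"
    then obtain i j where "a$1 = 2 * real i" "b$1 = 2 * real j + 1"
      using int by fastforce
    moreover have "real (2 * i) \<noteq> real (2 * j + 1)" unfolding of_nat_eq_iff by presburger
    ultimately show "a$1 \<noteq> b$1" by simp

  next
    fix a b assume "a \<in> stretch 0 0 ` S" "b \<in> stretch 0 0 ` S" "a$1 < b$1"
    then obtain p i j where "p \<in> S" "p$1 = real i" "b$1 = 2 * real j" "i < j" "a$1 = 2 * real i"
      using int by fastforce
    then show "\<exists>u\<in>stretch 1 t ` S. a$1 < u$1 \<and> u$1 < b$1"
      by (intro bexI[of _ "stretch 1 t p"]) auto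
  next
    fix a b assume "a \<in> stretch 1 t ` S" "b \<in> stretch 1 t ` S" "a$1 < b$1"
    then obtain p q where "p \<in> S" "q \<in> S" "a = stretch 1 t p" "b = stretch 1 t q" "p$1 < q$1"
      by auto
    moreover then obtain i j where "p$1 = real i" "q$1 = real j" "j < 2^d" using int by metis
    ultimately have ij: "b$1 = 2 * real j + 1" "i < j" "a$1 = 2 * real i + 1" "j < 2^d" by auto
    \<comment> \<open>Position 2(i + 1) separates 2i + 1 from 2j + 1, and i + 1 is a valid index
      because it is at most j.\<close>
    then obtain p where "p \<in> S" "p$1 = real (Suc i)" using int'[of "Suc i"] by auto
    then show "\<exists>u\<in>stretch 0 0 ` S. a$1 < u$1 \<and> u$1 < b$1"
      using ij by (intro bexI[of _ "stretch 0 0 p"]) auto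
  qed (use t horton_stretch[OF S] in auto)
  moreover have "(\<lambda>p. p$1) ` (stretch 0 0 ` S \<union> stretch 1 t ` S) = real ` {..<2 ^ Suc d}"
    (is "?l = ?r")
  proof
    show "?l \<subseteq> ?r"
    proof
      fix z assume "z \<in> ?l"
      then obtain i where "i < 2^d" "z = real (2 * i) \<or> z = real (2 * i + 1)"
        using int by fastforce
      moreover from this have "2 * i < 2 ^ Suc d" "2 * i + 1 < 2 ^ Suc d" by auto
      ultimately show "z \<in> ?r" by blast
    qed
    show "?r \<subseteq> ?l"
    proof
      fix z assume "z \<in> ?r"
      then obtain i where i: "z = real i" "i < 2 ^ Suc d" by auto
      then have "i div 2 < 2 ^ d" by auto
      then obtain p where p: "p \<in> S" "p$1 = real (i div 2)" using int' by blast
      show "z \<in> ?l"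
      proof (cases "even i")
        case True
        then have "z = stretch 0 0 p $ 1" using p i by (auto elim: evenE)
        then show ?thesis using p(1) by blast
      next
        case False
        then have "z = stretch 1 t p $ 1" using p i by (auto elim: oddE)
        then show ?thesis using p(1) by blast
      qed
    qed
  qed
  ultimately show ?case by blast
qed

section \<open>Points surrounded by convex subsets of a Horton set\<close>

text \<open>The gaps between consecutive values are disjoint, so their separators are distinct. The
  induction adds a largest element each time.\<close>

lemma card_le_Suc_separators:
  fixes f :: "'a \<Rightarrow> real" and g :: "'b \<Rightarrow> real"
  assumes "finite A" "inj_on f A" "finite G"
    and "\<And>a b. a \<in> A \<Longrightarrow> b \<in> A \<Longrightarrow> f a < f b \<Longrightarrow> \<exists>h\<in>G. f a < g h \<and> g h < f b"
  shows "card A \<le> Suc (card G)"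
  using assms
proof (induction A arbitrary: G rule: finite_ranking_induct[where f = f])
  case empty
  then show ?case by simp
next
  case (insert x S)
  show ?case
  proof (cases "x \<in> S \<or> S = {}")
    case True
    then show ?thesis using insert by (auto simp: insert_absorb)
  next
    case False
    have "Max (f ` S) \<in> f ` S" using insert.hyps False by (intro Max_in) auto
    then obtain w where w: "w \<in> S" "f w = Max (f ` S)" by force
    then have wmax: "f y \<le> f w" if "y \<in> S" for y using insert.hyps that by simp
    have "f w \<noteq> f x" using insert.prems(1) False w(1) by (metis inj_on_def insertCI)
    then have "f w < f x" using insert.hyps(2)[OF w(1)] by simp
    then obtain h where h: "h \<in> G" "f w < g h"
      using insert.prems(3)[of w x] w(1) by auto
    \<comment> \<open>\<open>G'\<close> still separates \<open>S\<close>, whose largest value is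
      \<open>f w\<close>, but it has lost the separator \<open>h\<close> of the new gap.\<close>
    define G' where "G' = {h \<in> G. g h < f w}"
    have "card S \<le> Suc (card G')"
    proof (rule insert.IH)
      fix a b assume ab: "a \<in> S" "b \<in> S" "f a < f b"
      then obtain h where "h \<in> G" "f a < g h" "g h < f b" using insert.prems(3)[of a b] by auto
      then show "\<exists>h\<in>G'. f a < g h \<and> g h < f b"
        using wmax[OF ab(2)] unfolding G'_def by force
    qed (use insert.prems in \<open>auto simp: G'_def\<close>)
    moreover have "card G' < card G"
      using h insert.prems(2) unfolding G'_def by (intro psubset_card_mono) force+
    ultimately show ?thesis using False insert.hyps(1) by simp
  qed
qed

text \<open>A cup that meets both halves has at most one upper point on either side of its lower points,
  and any two lower points are separated by an upper point of the Horton set, which lies above them.\<close>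
lemma horton_cup_below:
  assumes "horton S" "K \<subseteq> S" "cup K"
  shows "card K \<le> card {g \<in> S. \<exists>a\<in>K. \<exists>c\<in>K. a$1 < g$1 \<and> g$1 < c$1 \<and> orient a c g > 0} + 3"
  using assms
proof (induction arbitrary: K rule: horton.induct)
  case (single p)
  then have "card K \<le> card {p}" by (intro card_mono) auto
  then show ?case by simp
next
  case (join L U)
  let ?G = "\<lambda>S. {g \<in> S. \<exists>a\<in>K. \<exists>c\<in>K. a$1 < g$1 \<and> g$1 < c$1 \<and> orient a c g > 0}"
  have fin: "finite L" "finite U" using join.hyps horton_finite by auto
  have inj: "inj_on (\<lambda>p. p$1) (L \<union> U)"
    using horton_simple_position[OF horton.join[OF join.hyps]] by (simp add: simple_position_def)
  have mono: "card (?G L) \<le> card (?G (L \<union> U))" "card (?G U) \<le> card (?G (L \<union> U))"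
    using fin by (auto intro!: card_mono)
  consider "K \<subseteq> L" | "K \<subseteq> U" | e v where "e \<in> K \<inter> L" "v \<in> K \<inter> U"
    using join.prems by blast
  then show ?case
  proof cases
    case 1
    then show ?thesis using join.IH(1)[of K] join.prems mono(1) by auto
  next
    case 2
    then show ?thesis using join.IH(2)[of K] join.prems mono(2) by auto
  next
    case 3
    \<comment> \<open>In a cup, a point outside the span of a chord lies above the line of that
      chord; \<open>e\<close> lies below the line through \<open>o1\<close> and \<open>o2\<close>,
      so it must be between them.\<close>
    have between: "o1$1 < e$1 \<and> e$1 < o2$1"
      if o: "o1 \<in> K \<inter> U" "o2 \<in> K \<inter> U" "o1$1 < o2$1" for o1 o2
    proof -
      have neg: "orient o1 o2 e < 0" using join.hyps(7) o 3 by auto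
      have "e$1 \<noteq> o1$1" "e$1 \<noteq> o2$1" using join.hyps(3) o 3 by auto
      moreover have "\<not> o2$1 < e$1" using join.prems(2) neg o 3 unfolding cup_def by force
      moreover have "\<not> e$1 < o1$1"
        using join.prems(2) neg o 3 orient_rotate[of e o1 o2] unfolding cup_def by force
      ultimately show ?thesis by simp
    qed
    have injU: "o1 = o2" if "o1 \<in> K \<inter> U" "o2 \<in> K \<inter> U" "o1$1 = o2$1" for o1 o2
      using inj that by (auto dest: inj_onD)
    have "card {p \<in> K \<inter> U. p$1 < e$1} \<le> 1" "card {p \<in> K \<inter> U. e$1 < p$1} \<le> 1"
      using between injU fin
      by (auto simp: card_le_Suc0_iff_eq, (metis linorder_less_linear not_less_iff_gr_or_eq)+)
    moreover have "K \<inter> U = {p \<in> K \<inter> U. p$1 < e$1} \<union> {p \<in> K \<inter> U. e$1 < p$1}"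
      using join.hyps(3) 3 by (auto simp: neq_iff)
    ultimately have cU: "card (K \<inter> U) \<le> 2"
      by (metis (no_types, lifting) add_mono card_Un_le nat_1_add_1 order_trans)
    \<comment> \<open>One more than the separators here and at most two upper points: this is the
      constant 3.\<close>
    have "card (K \<inter> L) \<le> Suc (card (?G U))"
    proof (rule card_le_Suc_separators[where f = "\<lambda>p. p$1" and g = "\<lambda>p. p$1"])
      fix a b assume ab: "a \<in> K \<inter> L" "b \<in> K \<inter> L" "a$1 < b$1"
      then obtain u where "u \<in> U" "a$1 < u$1" "u$1 < b$1" using join.hyps(4)[of a b] by auto
      then show "\<exists>h\<in>?G U. a$1 < h$1 \<and> h$1 < b$1"
        using ab join.hyps(6)[of a b u] by blast
    qed (use fin inj in \<open>auto intro: inj_on_subset\<close>)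
    moreover have "card K \<le> card (K \<inter> L) + card (K \<inter> U)"
      using card_Un_le[of "K \<inter> L" "K \<inter> U"] join.prems(1) by (simp add: Int_Un_distrib[symmetric] Int_absorb2)
    ultimately show ?thesis using cU mono(2) by linarith
  qed
qed

lemma horton_cap_above:
  assumes "horton S" "K \<subseteq> S" "cap K"
  shows "card K \<le> card {g \<in> S. \<exists>a\<in>K. \<exists>c\<in>K. a$1 < g$1 \<and> g$1 < c$1 \<and> orient a c g < 0} + 3"
    (is "_ \<le> card ?G + 3")
proof -
  have inj: "inj_on reflect X" for X by (metis inj_on_inverseI reflect_reflect)
  have "card (reflect ` K) \<le> card {g \<in> reflect ` S. \<exists>a\<in>reflect ` K. \<exists>c\<in>reflect ` K.
      a$1 < g$1 \<and> g$1 < c$1 \<and> orient a c g > 0} + 3"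
    using assms by (intro horton_cup_below horton_reflect) (auto simp: cup_def cap_def)
  moreover have "{g \<in> reflect ` S. \<exists>a\<in>reflect ` K. \<exists>c\<in>reflect ` K.
      a$1 < g$1 \<and> g$1 < c$1 \<and> orient a c g > 0} = reflect ` ?G"
    by (auto intro!: imageI) blast+
  ultimately show ?thesis by (simp add: card_image[OF inj])
qed

text \<open>Descend to the last half that contains all of \<open>K\<close>. There \<open>K\<close>
  splits into a lower cup and an upper cap, each of which may exceed the number of points it
  captures by 3; the captured points lie in different halves, so the counts add.\<close>

lemma horton_convex_position:
  assumes "horton S" "K \<subseteq> S" "convex_position K"
  shows "card K \<le> card {g \<in> S. \<exists>a\<in>K. \<exists>b\<in>K. \<exists>c\<in>K. in_triangle g a b c} + 6"
  using assms
proof (induction arbitrary: K rule: horton.induct)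
  case (single p)
  then have "card K \<le> card {p}" by (intro card_mono) auto
  then show ?case by simp
next
  case (join L U)
  let ?G = "\<lambda>S. {g \<in> S. \<exists>a\<in>K. \<exists>b\<in>K. \<exists>c\<in>K. in_triangle g a b c}"
  have fin: "finite L" "finite U" using join.hyps horton_finite by auto
  have simple: "simple_position (L \<union> U)"
    using horton_simple_position[OF horton.join[OF join.hyps]] .
  have mono: "card (?G L) \<le> card (?G (L \<union> U))" "card (?G U) \<le> card (?G (L \<union> U))"
    using fin by (auto intro!: card_mono)
  consider "K \<subseteq> L" | "K \<subseteq> U" | l u where "l \<in> K \<inter> L" "u \<in> K \<inter> U"
    using join.prems by blast
  then show ?case
  proof cases
    case 1
    then show ?thesis using join.IH(1)[of K] join.prems mono(1) by auto
  next
    case 2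
    then show ?thesis using join.IH(2)[of K] join.prems mono(2) by auto
  next
    case 3
    \<comment> \<open>Since \<open>u\<close> is above every line spanned by \<open>L\<close>, a
      point of \<open>L\<close> above the chord from \<open>a\<close> to \<open>c\<close> is caught
      in the triangle with apex \<open>u\<close>. Applied to \<open>g\<close> in \<open>K\<close>
      this forces a cup; applied to any other \<open>g\<close> it yields an interior point.\<close>
    have triL: "in_triangle g a c u"
      if "a \<in> L" "g \<in> L" "c \<in> L" "a$1 < g$1" "g$1 < c$1" "orient a c g > 0" for a g c
      using that join.hyps(6)[of a g u] join.hyps(6)[of g c u] 3
        orient_rotate[of u a g] orient_rotate[of g c u]
      by (simp add: in_triangle_def)
    have triU: "in_triangle g c a l"
      if "a \<in> U" "g \<in> U" "c \<in> U" "a$1 < g$1" "g$1 < c$1" "orient a c g < 0" for a g c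
      using that join.hyps(7)[of a g l] join.hyps(7)[of g c l] 3
        orient_swap[of a c g] orient_swap[of a g l] orient_swap[of g c l]
        orient_rotate[of g a l] orient_rotate[of l c g] 
      by (simp add: in_triangle_def)
    have ne: "orient a b c \<noteq> 0"
      if "a \<in> L \<union> U" "b \<in> L \<union> U" "c \<in> L \<union> U" "a$1 < b$1" "b$1 < c$1" for a b c
      using simple that unfolding simple_position_def by (metis less_irrefl order_less_trans)
    have flip: "orient a c b = - orient a b c" for a b c
      by (simp add: orient_def algebra_simps)
    have "cup (K \<inter> L)"
      unfolding cup_def
    proof (intro ballI impI)
      fix a b c assume abc: "a \<in> K \<inter> L" "b \<in> K \<inter> L" "c \<in> K \<inter> L" "a$1 < b$1" "b$1 < c$1"
      have "\<not> orient a b c < 0"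
        using triL[of a b c] flip[of a c b] abc 3 join.prems(2) by (auto simp: convex_position_def)
      then show "orient a b c > 0" using ne[of a b c] abc by auto
    qed
    moreover have "cap (K \<inter> U)"
      unfolding cap_def
    proof (intro ballI impI)
      fix a b c assume abc: "a \<in> K \<inter> U" "b \<in> K \<inter> U" "c \<in> K \<inter> U" "a$1 < b$1" "b$1 < c$1"
      have "\<not> orient a b c > 0"
        using triU[of a b c] flip[of a c b] abc 3 join.prems(2) by (auto simp: convex_position_def)
      then show "orient a b c < 0" using ne[of a b c] abc by auto
    qed
    ultimately have
      "card (K \<inter> L) \<le> card {g \<in> L. \<exists>a\<in>K\<inter>L. \<exists>c\<in>K\<inter>L. a$1 < g$1 \<and> g$1 < c$1 \<and> orient a c g > 0} + 3"
        (is "_ \<le> card ?GL + 3")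
      "card (K \<inter> U) \<le> card {g \<in> U. \<exists>a\<in>K\<inter>U. \<exists>c\<in>K\<inter>U. a$1 < g$1 \<and> g$1 < c$1 \<and> orient a c g < 0} + 3"
        (is "_ \<le> card ?GU + 3")
      using horton_cup_below[OF join.hyps(1)] horton_cap_above[OF join.hyps(2)] by auto
    moreover have "?GL \<subseteq> ?G L"
    proof clarsimp
      fix g a c assume "g \<in> L" "a \<in> K" "a \<in> L" "a$1 < g$1" "c \<in> K" "c \<in> L" "g$1 < c$1" "orient a c g > 0"
      then show "\<exists>a\<in>K. \<exists>b\<in>K. Bex K (in_triangle g a b)" using triL[of a g c] 3 by blast
    qed
    then have "card ?GL \<le> card (?G L)" using fin by (intro card_mono) auto
    moreover have "?GU \<subseteq> ?G U"
    proof clarsimp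
      fix g a c assume "g \<in> U" "a \<in> K" "a \<in> U" "a$1 < g$1" "c \<in> K" "c \<in> U" "g$1 < c$1" "orient a c g < 0"
      then show "\<exists>a\<in>K. \<exists>b\<in>K. Bex K (in_triangle g a b)" using triU[of a g c] 3 by blast
    qed
    then have "card ?GU \<le> card (?G U)" using fin by (intro card_mono) auto
    moreover have "card (?G (L \<union> U)) = card (?G L) + card (?G U)"
    proof -
      have "?G (L \<union> U) = ?G L \<union> ?G U" by auto
      moreover have "?G L \<inter> ?G U = {}" using join.hyps(3) by auto
      ultimately show ?thesis using fin by (simp add: card_Un_disjoint)
    qed
    moreover have "card K \<le> card (K \<inter> L) + card (K \<inter> U)"
      using card_Un_le[of "K \<inter> L" "K \<inter> U"] join.prems(1) by (simp add: Int_Un_distrib[symmetric] Int_absorb2)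
    ultimately show ?thesis by linarith
  qed
qed

section \<open>Sets without large cups and caps\<close>

lemma orient_add [simp]: "orient (a + v) (b + v) (c + v) = orient a b c"
  by (simp add: orient_def)

lemma cup_add: "cup ((\<lambda>p. p + v) ` K) \<longleftrightarrow> cup K"
  by (simp add: cup_def)

lemma cap_add: "cap ((\<lambda>p. p + v) ` K) \<longleftrightarrow> cap K"
  by (simp add: cap_def)

lemma simple_position_add: "simple_position K \<Longrightarrow> simple_position ((\<lambda>p. p + v) ` K)"
  by (auto simp: simple_position_def inj_on_def)

text \<open>The shift \<open>s\<close> to the right is fixed first; afterwards each orientation is
  affine in the lift \<open>t\<close>, with a slope whose sign does not depend on
  \<open>s\<close>.\<close>

lemma high_translate_exists:
  assumes "finite L" "finite R"
  obtains v where "\<And>l r. l \<in> L \<Longrightarrow> r \<in> R \<Longrightarrow> l$1 < (r + v)$1"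
    and "\<And>l l' r. l \<in> L \<Longrightarrow> l' \<in> L \<Longrightarrow> r \<in> R \<Longrightarrow> l$1 < l'$1 \<Longrightarrow> orient l l' (r + v) > 0"
    and "\<And>l r r'. l \<in> L \<Longrightarrow> r \<in> R \<Longrightarrow> r' \<in> R \<Longrightarrow> r$1 < r'$1 \<Longrightarrow> orient l (r + v) (r' + v) < 0"
proof -
  have "\<forall>\<^sub>F s in at_top. \<forall>l\<in>L. \<forall>r\<in>R. 1 * s + (r$1 - l$1) > 0"
    by (intro eventually_ball_finite ballI eventually_affine_pos assms) auto
  then obtain s where s: "\<And>l r. l \<in> L \<Longrightarrow> r \<in> R \<Longrightarrow> 1 * s + (r$1 - l$1) > 0"
    using eventually_happens'[OF trivial_limit_at_top_linorder] by blast
  define v :: "real \<Rightarrow> point" where "v t = vector [s, t]" for t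
  have v [simp]: "v t $ 1 = s" "v t $ 2 = t" for t by (simp_all add: v_def)
  have 1: "\<forall>\<^sub>F t in at_top. \<forall>l\<in>L. \<forall>l'\<in>L. \<forall>r\<in>R. l$1 < l'$1 \<longrightarrow> orient l l' (r + v t) > 0"
  proof (intro eventually_ball_finite ballI assms)
    fix l l' r
    have e: "orient l l' (r + v t) =
      (l'$1 - l$1) * t + ((l'$1 - l$1) * (r$2 - l$2) - (l'$2 - l$2) * (r$1 + s - l$1))" for t
      by (simp add: orient_def algebra_simps)
    show "\<forall>\<^sub>F t in at_top. l$1 < l'$1 \<longrightarrow> orient l l' (r + v t) > 0"
      using eventually_affine_pos[of "l'$1 - l$1"] unfolding e by (cases "l$1 < l'$1") auto
  qed
  have 2: "\<forall>\<^sub>F t in at_top. \<forall>l\<in>L. \<forall>r\<in>R. \<forall>r'\<in>R. r$1 < r'$1 \<longrightarrow> orient l (r + v t) (r' + v t) < 0"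
  proof (intro eventually_ball_finite ballI assms)
    fix l r r'
    have e: "orient l (r + v t) (r' + v t) = - ((r'$1 - r$1) * t +
      ((r$2 - l$2) * (r'$1 + s - l$1) - (r$1 + s - l$1) * (r'$2 - l$2)))" for t
      by (simp add: orient_def algebra_simps)
    show "\<forall>\<^sub>F t in at_top. r$1 < r'$1 \<longrightarrow> orient l (r + v t) (r' + v t) < 0"
      using eventually_affine_pos[of "r'$1 - r$1"] unfolding e neg_less_0_iff_less
      by (cases "r$1 < r'$1") auto
  qed
  obtain t where t: "\<forall>l\<in>L. \<forall>l'\<in>L. \<forall>r\<in>R. l$1 < l'$1 \<longrightarrow> orient l l' (r + v t) > 0"
    "\<forall>l\<in>L. \<forall>r\<in>R. \<forall>r'\<in>R. r$1 < r'$1 \<longrightarrow> orient l (r + v t) (r' + v t) < 0"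
    using eventually_happens'[OF trivial_limit_at_top_linorder eventually_conj[OF 1 2]] by (elim exE conjE)
  show ?thesis
  proof
    show "l$1 < (r + v t)$1" if "l \<in> L" "r \<in> R" for l r using s[OF that] by simp
  qed (use t in auto)
qed

text \<open>Pascal's rule, with a set for (k, l + 1) on the left and one for (k + 1, l) high up on
  the right. A cup with a point on the left has at most one point on the right, and a cap with a
  point on the right has at most one on the left, so only the bound with room to spare grows by
  one.\<close>

lemma erdos_szekeres_set_exists:
  "\<exists>Y. finite Y \<and> simple_position Y \<and> card Y = (k + l) choose k \<and>
     (\<forall>K\<subseteq>Y. cup K \<longrightarrow> card K \<le> Suc k) \<and> (\<forall>K\<subseteq>Y. cap K \<longrightarrow> card K \<le> Suc l)"
proof -
  have base: "finite {0::point} \<and> simple_position {0} \<and> card {0::point} = 1 \<and>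
     (\<forall>K\<subseteq>{0}. cup K \<longrightarrow> card K \<le> Suc i) \<and> (\<forall>K\<subseteq>{0}. cap K \<longrightarrow> card K \<le> Suc j)" for i j
    by (auto simp: simple_position_def subset_singleton_iff)
  show ?thesis
  proof (induction k arbitrary: l)
    case 0
    show ?case using base[of 0 l] by (intro exI[of _ "{0}"]) (simp del: One_nat_def)
  next
    case (Suc k)
    note IHk = this
    show ?case
    proof (induction l)
      case 0
      show ?case using base[of "Suc k" 0] by (intro exI[of _ "{0}"]) (simp del: One_nat_def)
    next
      case (Suc l)
      obtain L where L: "finite L" "simple_position L" "card L = (k + Suc l) choose k"
        "\<And>K. K \<subseteq> L \<Longrightarrow> cup K \<Longrightarrow> card K \<le> Suc k" "\<And>K. K \<subseteq> L \<Longrightarrow> cap K \<Longrightarrow> card K \<le> Suc (Suc l)"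
        using IHk[of "Suc l"] by blast
      obtain R0 where R0: "finite R0" "simple_position R0" "card R0 = (Suc k + l) choose Suc k"
        "\<And>K. K \<subseteq> R0 \<Longrightarrow> cup K \<Longrightarrow> card K \<le> Suc (Suc k)" "\<And>K. K \<subseteq> R0 \<Longrightarrow> cap K \<Longrightarrow> card K \<le> Suc l"
        using Suc.IH by blast
      obtain v where v: "\<And>l r. l \<in> L \<Longrightarrow> r \<in> R0 \<Longrightarrow> l$1 < (r + v)$1"
        "\<And>l l' r. l \<in> L \<Longrightarrow> l' \<in> L \<Longrightarrow> r \<in> R0 \<Longrightarrow> l$1 < l'$1 \<Longrightarrow> orient l l' (r + v) > 0"
        "\<And>l r r'. l \<in> L \<Longrightarrow> r \<in> R0 \<Longrightarrow> r' \<in> R0 \<Longrightarrow> r$1 < r'$1 \<Longrightarrow> orient l (r + v) (r' + v) < 0"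
        using high_translate_exists[OF L(1) R0(1)] by blast
      define R where "R = (\<lambda>p. p + v) ` R0"
      have R: "finite R" "simple_position R" "card R = (Suc k + l) choose Suc k"
        using R0(1-3) by (auto simp: R_def simple_position_add card_image)
      have Rcup: "card K \<le> Suc (Suc k)" if K: "K \<subseteq> R" "cup K" for K
      proof -
        obtain K0 where "K0 \<subseteq> R0" "K = (\<lambda>p. p + v) ` K0"
          using K(1) unfolding R_def subset_image_iff by blast
        then show ?thesis using R0(4)[of K0] K(2) by (simp add: cup_add card_image)
      qed
      have Rcap: "card K \<le> Suc l" if K: "K \<subseteq> R" "cap K" for K
      proof -
        obtain K0 where "K0 \<subseteq> R0" "K = (\<lambda>p. p + v) ` K0"
          using K(1) unfolding R_def subset_image_iff by blast
        then show ?thesis using R0(5)[of K0] K(2) by (simp add: cap_add card_image)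
      qed
      have x: "a$1 < b$1" if "a \<in> L" "b \<in> R" for a b
        using v(1) that by (auto simp: R_def)
      have pos: "orient a a' b > 0" if "a \<in> L" "a' \<in> L" "b \<in> R" "a$1 < a'$1" for a a' b
        using v(2) that by (auto simp: R_def)
      have neg: "orient a b b' < 0" if "a \<in> L" "b \<in> R" "b' \<in> R" "b$1 < b'$1" for a b b'
        using v(3) that by (auto simp: R_def)
      have simple: "simple_position (L \<union> R)"
      proof (rule simple_position_Un[OF L(2) R(2)])
        show "a$1 \<noteq> b$1" if "a \<in> L" "b \<in> R" for a b using x[OF that] by simp
        show "orient a a' b \<noteq> 0" if "a \<in> L" "a' \<in> L" "b \<in> R" "a$1 < a'$1" for a a' b
          using pos[OF that] by simp
        show "orient b b' a \<noteq> 0" if "b \<in> R" "b' \<in> R" "a \<in> L" "b$1 < b'$1" for b b' a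
          using neg[of a b b'] that orient_rotate[of a b b'] by simp
      qed
      then have inj: "a = b" if "a \<in> L \<union> R" "b \<in> L \<union> R" "a$1 = b$1" for a b
        using that unfolding simple_position_def by (auto dest: inj_onD)
      have split: "card K \<le> card (K \<inter> L) + card (K \<inter> R)" if "K \<subseteq> L \<union> R" for K
        using card_Un_le[of "K \<inter> L" "K \<inter> R"] that by (simp add: Int_Un_distrib[symmetric] Int_absorb2)
      have "card K \<le> Suc (Suc k)" if K: "K \<subseteq> L \<union> R" "cup K" for K
      proof (cases "K \<subseteq> R")
        case False
        then obtain a where a: "a \<in> K" "a \<in> L" using K(1) by blast
        have "\<not> b$1 < b'$1" if "b \<in> K \<inter> R" "b' \<in> K \<inter> R" for b b'
          using neg[of a b b'] x[of a b] that a K(2) unfolding cup_def by force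
        then have "b = b'" if "b \<in> K \<inter> R" "b' \<in> K \<inter> R" for b b'
          using inj[of b b'] that by (metis IntD2 UnI2 linorder_neqE)
        then have "card (K \<inter> R) \<le> 1" using R(1) by (simp add: card_le_Suc0_iff_eq)
        moreover have "card (K \<inter> L) \<le> Suc k" using K(2) by (intro L(4)) (auto simp: cup_def)
        ultimately show ?thesis using split[OF K(1)] by linarith
      qed (use Rcup K in blast)
      moreover have "card K \<le> Suc (Suc l)" if K: "K \<subseteq> L \<union> R" "cap K" for K
      proof (cases "K \<subseteq> L")
        case False
        then obtain b where b: "b \<in> K" "b \<in> R" using K(1) by blast
        have "\<not> a$1 < a'$1" if "a \<in> K \<inter> L" "a' \<in> K \<inter> L" for a a'
          using pos[of a a' b] x[of a' b] that b K(2) unfolding cap_def by force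
        then have "a = a'" if "a \<in> K \<inter> L" "a' \<in> K \<inter> L" for a a'
          using inj[of a a'] that by (metis IntD2 UnI1 linorder_neqE)
        then have "card (K \<inter> L) \<le> 1" using L(1) by (simp add: card_le_Suc0_iff_eq)
        moreover have "card (K \<inter> R) \<le> Suc l" using K(2) by (intro Rcap) (auto simp: cap_def)
        ultimately show ?thesis using split[OF K(1)] by linarith
      qed (use L(5) K in blast)
      moreover have "card (L \<union> R) = (Suc k + Suc l) choose Suc k"
      proof -
        have "L \<inter> R = {}" using x by fastforce
        then show ?thesis using L R by (simp add: card_Un_disjoint)
      qed
      ultimately show ?case using L(1) R(1) simple by (intro exI[of _ "L \<union> R"]) auto
    qed
  qed
qed

text \<open>A point that lies below one chord of \<open>Z\<close> and above another is inside a triangle of \<open>Z\<close>; so the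
  points below no chord and the points above no chord cover \<open>Z\<close>.\<close>
lemma card_convex_position_le:
  assumes "finite Z" "simple_position Z" "convex_position Z"
    and cups: "\<And>K. K \<subseteq> Z \<Longrightarrow> cup K \<Longrightarrow> card K \<le> p"
    and caps: "\<And>K. K \<subseteq> Z \<Longrightarrow> cap K \<Longrightarrow> card K \<le> q"
  shows "card Z \<le> p + q"
proof -
  define D where "D = {z\<in>Z. \<forall>a\<in>Z. \<forall>c\<in>Z. a$1 < z$1 \<longrightarrow> z$1 < c$1 \<longrightarrow> orient a z c \<ge> 0}"
  define U where "U = {z\<in>Z. \<forall>a\<in>Z. \<forall>c\<in>Z. a$1 < z$1 \<longrightarrow> z$1 < c$1 \<longrightarrow> orient a z c \<le> 0}"
  have ne: "orient a b c \<noteq> 0" if "a \<in> Z" "b \<in> Z" "c \<in> Z" "a$1 \<noteq> b$1" "b$1 \<noteq> c$1" "a$1 \<noteq> c$1" for a b c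
  proof -
    have "a \<noteq> b" "b \<noteq> c" "a \<noteq> c" using that by auto
    then show ?thesis using assms(2) that(1-3) unfolding simple_position_def by blast
  qed
  have "z \<in> D \<union> U" if z: "z \<in> Z" for z
  proof (rule ccontr)
    assume "z \<notin> D \<union> U"
    then obtain a c a' c' where mem: "a \<in> Z" "c \<in> Z" "a' \<in> Z" "c' \<in> Z"
      and x: "a$1 < z$1" "z$1 < c$1" "a'$1 < z$1" "z$1 < c'$1"
      and o: "orient a z c > 0" "orient a' z c' < 0"
      using z unfolding D_def U_def by (simp add: not_le) blast
    \<comment> \<open>The slope of the line from \<open>z\<close> to \<open>p\<close>. Slopes and
      sides of \<open>z\<close> determine all orientations at \<open>z\<close>.\<close>
    define s :: "point \<Rightarrow> real" where "s p = (p$2 - z$2) / (p$1 - z$1)" for p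
    have orient: "orient z p q = (p$1 - z$1) * (q$1 - z$1) * (s q - s p)"
      if "p$1 \<noteq> z$1" "q$1 \<noteq> z$1" for p q
    proof -
      have e: "p$2 = z$2 + s p * (p$1 - z$1)" "q$2 = z$2 + s q * (q$1 - z$1)"
        using that by (simp_all add: s_def)
      show ?thesis unfolding orient_def e by (simp add: algebra_simps)
    qed
    \<comment> \<open>If \<open>p\<close> and \<open>q\<close> are on one side of \<open>z\<close>,
      and \<open>r\<close> on the other has a slope strictly between theirs, then \<open>z\<close>
      is inside the triangle.\<close>
    have tri: False if "p \<in> Z" "q \<in> Z" "r \<in> Z" "(p$1 - z$1) * (q$1 - z$1) > 0"
      "(p$1 - z$1) * (r$1 - z$1) < 0" "(q$1 - z$1) * (r$1 - z$1) < 0" "s p < s r" "s r < s q" for p q r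
    proof -
      have "p$1 \<noteq> z$1" "q$1 \<noteq> z$1" "r$1 \<noteq> z$1" using that(4-6) by auto
      then have "orient z p q > 0" "orient z q r > 0" "orient z r p > 0"
        using that(4-8) by (simp_all add: orient mult_neg_neg mult.commute[of "r$1 - z$1"])
      then have "in_triangle z p q r" by (simp add: in_triangle_def orient_rotate[of z])
      then show False using assms(3) z that unfolding convex_position_def by blast
    qed
    have sgn: "(c$1 - z$1) * (a$1 - z$1) < 0" "(c'$1 - z$1) * (a'$1 - z$1) < 0"
      "(a$1 - z$1) * (a'$1 - z$1) > 0" "(c$1 - z$1) * (c'$1 - z$1) > 0"
      "(c'$1 - z$1) * (a$1 - z$1) < 0" "(c$1 - z$1) * (a'$1 - z$1) < 0"
      using x by (simp_all add: mult_pos_pos mult_neg_neg mult_pos_neg)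
    have "(c$1 - z$1) * (a$1 - z$1) * (s a - s c) > 0" "(c'$1 - z$1) * (a'$1 - z$1) * (s a' - s c') < 0"
      using o x orient[of c a] orient[of c' a'] by (simp_all add: orient_rotate[of _ z])
    then have "s a < s c" "s c' < s a'"
      using sgn(1,2) by (auto simp: zero_less_mult_iff mult_less_0_iff)
    moreover have "s c \<noteq> s a'"
    proof
      assume "s c = s a'"
      then have "orient z c a' = 0" using orient[of c a'] x by simp
      then show False using ne[of z c a'] x mem z by simp
    qed
    \<comment> \<open>However \<open>s c\<close> and \<open>s a'\<close> compare, some slope lies
      strictly between two slopes from the opposite side.\<close>
    ultimately consider "s a < s c" "s c < s a'" | "s c' < s a'" "s a' < s c" | "s c' < s a" "s a < s c"
      by linarith
    then show False
    proof cases
      case 1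
      then show ?thesis using tri[of a a' c] mem sgn by (simp add: mult.commute)
    next
      case 2
      then show ?thesis using tri[of c' c a'] mem sgn by (simp add: mult.commute)
    next
      case 3
      then show ?thesis using tri[of c' c a] mem sgn by (simp add: mult.commute)
    qed
  qed
  then have "card Z \<le> card (D \<union> U)" using assms(1) by (intro card_mono) (auto simp: D_def U_def)
  also have "\<dots> \<le> card D + card U" by (rule card_Un_le)
  also have "card D \<le> p"
  proof (rule cups)
    show "cup D" unfolding cup_def
    proof (intro ballI impI)
      fix a b c assume "a \<in> D" "b \<in> D" "c \<in> D" "a$1 < b$1" "b$1 < c$1"
      then show "orient a b c > 0" using ne[of a b c] by (force simp: D_def order_less_le)
    qed
  qed (auto simp: D_def)
  also have "card U \<le> q"
  proof (rule caps)
    show "cap U" unfolding cap_def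
    proof (intro ballI impI)
      fix a b c assume "a \<in> U" "b \<in> U" "c \<in> U" "a$1 < b$1" "b$1 < c$1"
      then show "orient a b c < 0" using ne[of a b c] by (force simp: U_def order_less_le)
    qed
  qed (auto simp: U_def)
  finally show ?thesis by simp
qed

section \<open>Replacing points by thin clusters\<close>

text \<open>Interchanging the coordinates makes the clusters nearly vertical for small \<open>e\<close>, and reverses the
  orientation inside a cluster.\<close>
definition blowup :: "real \<Rightarrow> point \<Rightarrow> point \<Rightarrow> point" where
  "blowup e h y = vector [h$1 + e^2 * y$2, h$2 + e * y$1]"

lemma blowup_nth [simp]:
  "blowup e h y $ 1 = h$1 + e^2 * y$2" "blowup e h y $ 2 = h$2 + e * y$1"
  by (simp_all add: blowup_def)

lemma orient_blowup_same:
  "orient (blowup e h a) (blowup e h b) (blowup e h c) = - (e^3 * orient a b c)"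
  by (simp add: orient_def algebra_simps power2_eq_square power3_eq_cube)

text \<open>The last clause treats both sides at once: going up the line through two points of a
  cluster, clusters on the right give a negative orientation and those on the left a positive
  one.\<close>

definition thin :: "real \<Rightarrow> point set \<Rightarrow> point set \<Rightarrow> bool" where
  "thin e H Y \<longleftrightarrow> e > 0 \<and>
    (\<forall>h\<in>H. \<forall>h'\<in>H. \<forall>y\<in>Y. \<forall>y'\<in>Y. h$1 < h'$1 \<longrightarrow> blowup e h y $ 1 < blowup e h' y' $ 1) \<and>
    (\<forall>h\<in>H. \<forall>h'\<in>H. \<forall>h''\<in>H. \<forall>y\<in>Y. \<forall>y'\<in>Y. \<forall>y''\<in>Y. orient h h' h'' > 0 \<longrightarrow>
       orient (blowup e h y) (blowup e h' y') (blowup e h'' y'') > 0) \<and>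
    (\<forall>h\<in>H. \<forall>h'\<in>H. \<forall>y\<in>Y. \<forall>y'\<in>Y. \<forall>y''\<in>Y. h$1 \<noteq> h'$1 \<longrightarrow> y$1 < y'$1 \<longrightarrow>
       (h'$1 - h$1) * orient (blowup e h y) (blowup e h y') (blowup e h' y'') < 0)"

lemma thin_exists:
  assumes "finite H" "finite Y"
  obtains e where "thin e H Y"
proof -
  have "\<forall>\<^sub>F e in at_right 0. (e::real) > 0" by (rule eventually_at_right_less)
  moreover have "\<forall>\<^sub>F e in at_right 0. \<forall>h\<in>H. \<forall>h'\<in>H. \<forall>y\<in>Y. \<forall>y'\<in>Y. h$1 < h'$1 \<longrightarrow>
      blowup e h y $ 1 < blowup e h' y' $ 1"
  proof (intro eventually_ball_finite ballI assms)
    fix h h' y y' :: point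
    have "((\<lambda>e. blowup e h' y' $ 1 - blowup e h y $ 1) \<longlongrightarrow>
        (h'$1 + 0^2 * y'$2) - (h$1 + 0^2 * y$2)) (at_right 0)"
      unfolding blowup_nth by (intro tendsto_intros)
    from order_tendstoD(1)[OF this, of 0]
    show "\<forall>\<^sub>F e in at_right 0. h$1 < h'$1 \<longrightarrow> blowup e h y $ 1 < blowup e h' y' $ 1"
      by (cases "h$1 < h'$1") (simp_all add: less_diff_eq)
  qed
  moreover have "\<forall>\<^sub>F e in at_right 0. \<forall>h\<in>H. \<forall>h'\<in>H. \<forall>h''\<in>H. \<forall>y\<in>Y. \<forall>y'\<in>Y. \<forall>y''\<in>Y.
      orient h h' h'' > 0 \<longrightarrow> orient (blowup e h y) (blowup e h' y') (blowup e h'' y'') > 0"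
  proof (intro eventually_ball_finite ballI assms)
    fix h h' h'' y y' y'' :: point
    have "((\<lambda>e. orient (blowup e h y) (blowup e h' y') (blowup e h'' y'')) \<longlongrightarrow>
        ((h'$1 + 0^2 * y'$2) - (h$1 + 0^2 * y$2)) * ((h''$2 + 0 * y''$1) - (h$2 + 0 * y$1)) -
        ((h'$2 + 0 * y'$1) - (h$2 + 0 * y$1)) * ((h''$1 + 0^2 * y''$2) - (h$1 + 0^2 * y$2))) (at_right 0)"
      unfolding orient_def blowup_nth by (intro tendsto_intros)
    from order_tendstoD(1)[OF this, of 0]
    show "\<forall>\<^sub>F e in at_right 0. orient h h' h'' > 0 \<longrightarrow>
        orient (blowup e h y) (blowup e h' y') (blowup e h'' y'') > 0"
      by (cases "orient h h' h'' > 0") (simp_all add: orient_def[of h h' h''])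
  qed
  moreover have "\<forall>\<^sub>F e in at_right 0. \<forall>h\<in>H. \<forall>h'\<in>H. \<forall>y\<in>Y. \<forall>y'\<in>Y. \<forall>y''\<in>Y. h$1 \<noteq> h'$1 \<longrightarrow> y$1 < y'$1 \<longrightarrow>
      (h'$1 - h$1) * orient (blowup e h y) (blowup e h y') (blowup e h' y'') < 0"
  proof (intro eventually_ball_finite ballI assms)
    fix h h' y y' y'' :: point
    \<comment> \<open>The orientation itself tends to 0, so a factor \<open>e\<close> is split off.
      Clusters have width of order \<open>e^2\<close> but height of order \<open>e\<close>, hence
      \<open>F\<close> has a negative limit.\<close>
    define F where "F e = (h'$1 - h$1) * (e * (y'$2 - y$2) * (h'$2 + e * y''$1 - (h$2 + e * y$1)) -
        (y'$1 - y$1) * (h'$1 + e^2 * y''$2 - (h$1 + e^2 * y$2)))" for e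
    have F: "(h'$1 - h$1) * orient (blowup e h y) (blowup e h y') (blowup e h' y'') = e * F e" for e
      by (simp add: F_def orient_def algebra_simps power2_eq_square)
    have "(F \<longlongrightarrow> (h'$1 - h$1) * (0 * (y'$2 - y$2) * (h'$2 + 0 * y''$1 - (h$2 + 0 * y$1)) -
        (y'$1 - y$1) * (h'$1 + 0^2 * y''$2 - (h$1 + 0^2 * y$2)))) (at_right 0)"
      unfolding F_def by (intro tendsto_intros)
    also have "(h'$1 - h$1) * (0 * (y'$2 - y$2) * (h'$2 + 0 * y''$1 - (h$2 + 0 * y$1)) -
        (y'$1 - y$1) * (h'$1 + 0^2 * y''$2 - (h$1 + 0^2 * y$2))) = - ((y'$1 - y$1) * (h'$1 - h$1)^2)"
      by (simp add: power2_eq_square algebra_simps)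
    finally have lim: "(F \<longlongrightarrow> - ((y'$1 - y$1) * (h'$1 - h$1)^2)) (at_right 0)" .
    show "\<forall>\<^sub>F e in at_right 0. h$1 \<noteq> h'$1 \<longrightarrow> y$1 < y'$1 \<longrightarrow>
      (h'$1 - h$1) * orient (blowup e h y) (blowup e h y') (blowup e h' y'') < 0"
    proof (cases "h$1 \<noteq> h'$1 \<and> y$1 < y'$1")
      case True
      then have "- ((y'$1 - y$1) * (h'$1 - h$1)^2) < 0" by simp
      from order_tendstoD(2)[OF lim this] eventually_at_right_less[of 0]
      show ?thesis unfolding F by eventually_elim (simp add: mult_pos_neg)
    qed auto
  qed
  ultimately have "\<forall>\<^sub>F e in at_right 0. thin e H Y"
    unfolding thin_def by (intro eventually_conj)
  then show ?thesis using that eventually_happens'[OF trivial_limit_at_right_real] by blast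
qed

lemma thin_inj:
  assumes "thin e H Y" "simple_position H" "simple_position Y"
  shows "inj_on (\<lambda>(h, y). blowup e h y) (H \<times> Y)"
proof (intro inj_onI, clarify)
  fix h y h' y' assume mem: "h \<in> H" "y \<in> Y" "h' \<in> H" "y' \<in> Y" and eq: "blowup e h y = blowup e h' y'"
  have "e > 0" using assms(1) by (simp add: thin_def)
  have "\<not> h$1 < h'$1" "\<not> h'$1 < h$1"
    using assms(1) mem eq unfolding thin_def by (metis less_irrefl)+
  then have "h = h'" using assms(2) mem unfolding simple_position_def by (auto dest: inj_onD)
  moreover then have "y$1 = y'$1"
    using arg_cong[OF eq, of "\<lambda>p. p$2"] \<open>e > 0\<close> by simp
  ultimately show "h = h' \<and> y = y'"
    using assms(3) mem unfolding simple_position_def by (auto dest: inj_onD)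
qed

lemma thin_side:
  assumes "thin e H Y" "h \<in> H" "h' \<in> H" "y \<in> Y" "y' \<in> Y" "y'' \<in> Y" "y$1 < y'$1"
  shows "h$1 < h'$1 \<Longrightarrow> orient (blowup e h y) (blowup e h y') (blowup e h' y'') < 0"
    and "h'$1 < h$1 \<Longrightarrow> orient (blowup e h y) (blowup e h y') (blowup e h' y'') > 0"
proof -
  have *: "h$1 \<noteq> h'$1 \<Longrightarrow> (h'$1 - h$1) * orient (blowup e h y) (blowup e h y') (blowup e h' y'') < 0"
    using assms unfolding thin_def by blast
  show "h$1 < h'$1 \<Longrightarrow> orient (blowup e h y) (blowup e h y') (blowup e h' y'') < 0"
    and "h'$1 < h$1 \<Longrightarrow> orient (blowup e h y) (blowup e h y') (blowup e h' y'') > 0"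
    using * by (auto simp: mult_less_0_iff)
qed

lemma thin_orient_pos:
  assumes "thin e H Y" "h \<in> H" "h' \<in> H" "h'' \<in> H" "y \<in> Y" "y' \<in> Y" "y'' \<in> Y" "orient h h' h'' > 0"
  shows "orient (blowup e h y) (blowup e h' y') (blowup e h'' y'') > 0"
  using assms unfolding thin_def by blast

text \<open>General position of the blow-up: three points of one cluster inherit it from
  \<open>Y\<close>, three clusters inherit it from \<open>H\<close>, and two points of one cluster
  span a line that misses all other clusters.\<close>

lemma thin_orient_nonzero:
  assumes thin: "thin e H Y" and H: "simple_position H" and Y: "simple_position Y"
    and mem: "h \<in> H" "h' \<in> H" "h'' \<in> H" "y \<in> Y" "y' \<in> Y" "y'' \<in> Y"
    and ne: "(h, y) \<noteq> (h', y')" "(h, y) \<noteq> (h'', y'')" "(h', y') \<noteq> (h'', y'')"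
  shows "orient (blowup e h y) (blowup e h' y') (blowup e h'' y'') \<noteq> 0"
proof -
  have two: "orient (blowup e a u) (blowup e a v) (blowup e b w) \<noteq> 0"
    if "a \<in> H" "b \<in> H" "u \<in> Y" "v \<in> Y" "w \<in> Y" "a \<noteq> b" "u \<noteq> v" for a b u v w
  proof -
    have "a$1 \<noteq> b$1" "u$1 \<noteq> v$1"
      using H Y that unfolding simple_position_def by (auto dest: inj_onD)
    then consider "u$1 < v$1" | "v$1 < u$1" by linarith
    then show ?thesis
    proof cases
      case 1
      then show ?thesis
        using thin_side[OF thin that(1-5)] \<open>a$1 \<noteq> b$1\<close> by (cases "a$1 < b$1") auto
    next
      case 2
      then have "orient (blowup e a v) (blowup e a u) (blowup e b w) \<noteq> 0"
        using thin_side[OF thin that(1,2,4,3,5)] \<open>a$1 \<noteq> b$1\<close> by (cases "a$1 < b$1") auto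
      then show ?thesis by (simp add: orient_swap[of _ "blowup e a u"])
    qed
  qed
  consider (same) "h = h'" "h' = h''" | (12) "h = h'" "h \<noteq> h''" | (23) "h' = h''" "h \<noteq> h'"
    | (13) "h = h''" "h \<noteq> h'" | (distinct) "h \<noteq> h'" "h \<noteq> h''" "h' \<noteq> h''" by blast
  then show ?thesis
  proof cases
    case same
    then have "orient y y' y'' \<noteq> 0" using Y mem ne unfolding simple_position_def by blast
    then show ?thesis using same thin by (simp add: orient_blowup_same thin_def)
  next
    case 12
    then show ?thesis using two[of h h'' y y' y''] mem ne by simp
  next
    case 23
    then show ?thesis using two[of h' h y' y'' y] mem ne
      by (simp add: orient_rotate[of "blowup e h y"])
  next
    case 13
    then show ?thesis using two[of h h' y'' y y'] mem ne
      by (simp add: orient_rotate[of "blowup e h'' y''"])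
  next
    case distinct
    then have "orient h h' h'' \<noteq> 0" using H mem unfolding simple_position_def by blast
    then consider "orient h h' h'' > 0" | "orient h' h h'' > 0"
      using orient_swap[of h h' h''] by linarith
    then show ?thesis
    proof cases
      case 1
      then show ?thesis using thin_orient_pos[OF thin mem] by simp
    next
      case 2
      then have "orient (blowup e h' y') (blowup e h y) (blowup e h'' y'') \<noteq> 0"
        using thin_orient_pos[OF thin mem(2,1,3,5,4,6)] by simp
      then show ?thesis by (simp add: orient_swap[of _ "blowup e h y"])
    qed
  qed
qed

text \<open>The representatives are arbitrary. This serves both to pull convex position back to
  \<open>H\<close> and to place whole clusters inside a polygon.\<close>

lemma in_triangle_blowup:
  assumes "thin e H Y" "in_triangle g a b c" "g \<in> H" "a \<in> H" "b \<in> H" "c \<in> H"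
    "t \<in> Y" "u \<in> Y" "v \<in> Y" "w \<in> Y"
  shows "in_triangle (blowup e g t) (blowup e a u) (blowup e b v) (blowup e c w)"
  using assms thin_orient_pos[OF assms(1)] unfolding in_triangle_def by blast

section \<open>Counting vertices and interior points of polygons in the blow-up\<close>

text \<open>With c >= 2 clusters the total is (m + 1) + (m + 1) + (c - 2). The \<open>max 2\<close>
  covers a polygon inside a single cluster, which is a cup and a cap together.\<close>

lemma card_convex_position_clusters:
  assumes thin: "thin e H Y" and fin: "finite H" "finite Y"
    and H: "simple_position H" and Y: "simple_position Y"
    and cups: "\<And>K. K \<subseteq> Y \<Longrightarrow> cup K \<Longrightarrow> card K \<le> Suc m"
    and caps: "\<And>K. K \<subseteq> Y \<Longrightarrow> cap K \<Longrightarrow> card K \<le> Suc m"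
    and D: "D \<subseteq> H \<times> Y" "convex_position ((\<lambda>(h, y). blowup e h y) ` D)"
  shows "card D \<le> 2 * m + max 2 (card (fst ` D))"
proof -
  define K where "K = fst ` D"
  define F where "F h = {y. (h, y) \<in> D}" for h
  have "e > 0" using thin by (simp add: thin_def)
  have "finite D" using D(1) fin by (meson finite_SigmaI finite_subset)
  then have K: "K \<subseteq> H" "finite K" using D(1) by (auto simp: K_def)
  have F: "F h \<subseteq> Y" "finite (F h)" for h using D(1) fin(2) by (auto simp: F_def intro: finite_subset)
  have "D = Sigma K F" by (force simp: K_def F_def)
  then have cardD: "card D = (\<Sum>h\<in>K. card (F h))" using K F by simp
  have conv: "\<not> in_triangle (blowup e h x) (blowup e a u) (blowup e b v) (blowup e c w)"
    if "x \<in> F h" "u \<in> F a" "v \<in> F b" "w \<in> F c" for x h u a v b w c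
    using D(2) that unfolding convex_position_def F_def by fast
  have F_ne: "\<exists>y. y \<in> F h" if "h \<in> K" for h using that by (auto simp: K_def F_def)
  have orient_F: "orient a b c \<noteq> 0" if "a \<in> F h" "b \<in> F h" "c \<in> F h" "a$1 < b$1" "b$1 < c$1" for h a b c
  proof -
    have "a \<noteq> b" "b \<noteq> c" "a \<noteq> c" using that by auto
    then show ?thesis using Y F[of h] that(1-3) unfolding simple_position_def by blast
  qed
  \<comment> \<open>A point of another cluster to the right (left) forces the vertices in this one to form a cup (cap).\<close>
  have left: "card (F h) \<le> Suc m" if h: "h \<in> K" "h' \<in> K" "h$1 < h'$1" for h h'
  proof (rule cups[OF F(1)], unfold cup_def, intro ballI impI)
    fix a b c assume abc: "a \<in> F h" "b \<in> F h" "c \<in> F h" "a$1 < b$1" "b$1 < c$1"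
    obtain y where y: "y \<in> F h'" using F_ne h by blast
    let ?A = "blowup e h a" and ?B = "blowup e h b" and ?C = "blowup e h c" and ?P = "blowup e h' y"
    have "orient ?A ?B ?P < 0" "orient ?B ?C ?P < 0"
      using thin_side(1)[OF thin, of h h'] abc h y K F by blast+
    then have "orient ?A ?P ?B > 0" "orient ?P ?C ?B > 0"
      using orient_rotate[of ?A ?B ?P] orient_swap[of ?B ?P ?A] orient_rotate[of ?A ?P ?B]
        orient_rotate[of ?P ?C ?B] orient_swap[of ?B ?C ?P] orient_rotate[of ?C ?B ?P] orient_swap[of ?P ?B ?A]
        orient_rotate[of ?P ?B ?A] orient_rotate[of ?B ?A ?P]
      by linarith+
    \<comment> \<open>The points run upwards and \<open>?P\<close> is to their right; a left turn at
      \<open>?B\<close> would put \<open>?B\<close> inside the triangle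
      \<open>?A ?P ?C\<close>.\<close>
    then have "\<not> orient ?A ?B ?C > 0"
      using conv[of b h a h y h' c h] abc y orient_rotate[of ?C ?A ?B] by (auto simp: in_triangle_def)
    then have "e^3 * orient a b c \<ge> 0" by (simp add: orient_blowup_same)
    then show "orient a b c > 0"
      using \<open>e > 0\<close> orient_F[OF abc] by (simp add: zero_le_mult_iff)
  qed
  have right: "card (F h) \<le> Suc m" if h: "h \<in> K" "h' \<in> K" "h'$1 < h$1" for h h'
  proof (rule caps[OF F(1)], unfold cap_def, intro ballI impI)
    fix a b c assume abc: "a \<in> F h" "b \<in> F h" "c \<in> F h" "a$1 < b$1" "b$1 < c$1"
    obtain y where y: "y \<in> F h'" using F_ne h by blast
    let ?A = "blowup e h a" and ?B = "blowup e h b" and ?C = "blowup e h c" and ?P = "blowup e h' y"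
    have "orient ?A ?B ?P > 0" "orient ?B ?C ?P > 0"
      using thin_side(2)[OF thin, of h h'] abc h y K F by blast+
    then have "orient ?P ?A ?B > 0" "orient ?C ?P ?B > 0"
      using orient_rotate[of ?P ?A ?B] orient_rotate[of ?B ?C ?P] by simp_all
    then have "\<not> orient ?A ?B ?C < 0"
      using conv[of b h c h y h' a h] abc y orient_rotate[of ?C ?A ?B] orient_swap[of ?A ?C ?B]
      by (auto simp: in_triangle_def)
    then have "e^3 * orient a b c \<le> 0" by (simp add: orient_blowup_same)
    then show "orient a b c < 0"
      using \<open>e > 0\<close> orient_F[OF abc] by (simp add: mult_le_0_iff)
  qed
  \<comment> \<open>Of two vertices in a middle cluster, the one nearer to the chord between the
    outer clusters is inside the triangle formed by the other and the ends of the chord: the lower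
    one if the cluster is above the chord, else the upper one.\<close>
  have middle: "card (F h) \<le> 1" if h: "h1 \<in> K" "h \<in> K" "h2 \<in> K" "h1$1 < h$1" "h$1 < h2$1" for h1 h h2
  proof -
    obtain u v where uv: "u \<in> F h1" "v \<in> F h2" using F_ne h by blast
    have False if y: "y \<in> F h" "y' \<in> F h" "y$1 < y'$1" for y y'
    proof -
      let ?A = "blowup e h1 u" and ?B = "blowup e h2 v" and ?P = "blowup e h y" and ?Q = "blowup e h y'"
      note KH = subsetD[OF K(1)] and FY = subsetD[OF F(1)]
      have "orient ?P ?Q ?B < 0" "orient ?P ?Q ?A > 0"
        using thin_side(1)[OF thin KH[OF h(2)] KH[OF h(3)] FY[OF y(1)] FY[OF y(2)] FY[OF uv(2)] y(3) h(5)]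
          thin_side(2)[OF thin KH[OF h(2)] KH[OF h(1)] FY[OF y(1)] FY[OF y(2)] FY[OF uv(1)] y(3) h(4)] .
      then have s: "orient ?B ?Q ?P > 0" "orient ?Q ?A ?P > 0" "orient ?A ?P ?Q > 0" "orient ?P ?B ?Q > 0"
        using orient_rotate[of ?B ?Q ?P] orient_swap[of ?P ?Q ?B] orient_rotate[of ?Q ?A ?P]
          orient_rotate[of ?A ?P ?Q] orient_rotate[of ?P ?B ?Q] by linarith+
      have "h1 \<noteq> h2" "h1 \<noteq> h" "h2 \<noteq> h" using h by auto
      then have "orient h1 h2 h \<noteq> 0" using H K h unfolding simple_position_def by blast
      then consider "orient h1 h2 h > 0" | "orient h2 h1 h > 0"
        using orient_swap[of h1 h2 h] by linarith
      then show False
      proof cases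
        case 1
        have "orient ?A ?B ?P > 0"
          by (rule thin_orient_pos[OF thin KH[OF h(1)] KH[OF h(3)] KH[OF h(2)] FY[OF uv(1)] FY[OF uv(2)] FY[OF y(1)] 1])
        then have "in_triangle ?P ?A ?B ?Q" using s by (simp add: in_triangle_def)
        then show False using conv[OF y(1) uv y(2)] by simp
      next
        case 2
        have "orient ?B ?A ?Q > 0"
          by (rule thin_orient_pos[OF thin KH[OF h(3)] KH[OF h(1)] KH[OF h(2)] FY[OF uv(2)] FY[OF uv(1)] FY[OF y(2)] 2])
        then have "in_triangle ?Q ?B ?A ?P" using s by (simp add: in_triangle_def)
        then show False using conv[OF y(2) uv(2,1) y(1)] by simp
      qed
    qed
    then have "y$1 = y'$1" if "y \<in> F h" "y' \<in> F h" for y y' using that by (metis linorder_neqE)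
    then have "y = y'" if "y \<in> F h" "y' \<in> F h" for y y'
      using that Y F(1)[of h] unfolding simple_position_def by (meson inj_onD subsetD)
    then show ?thesis using F(2) by (simp add: card_le_Suc0_iff_eq)
  qed
  have xinj: "inj_on (\<lambda>p. p$1) K" using H K(1) unfolding simple_position_def by (meson inj_on_subset)
  have "card K = 0 \<or> card K = 1 \<or> card K \<ge> 2" by linarith
  then consider "K = {}" | h where "K = {h}" | "card K \<ge> 2"
    using K(2) by (auto simp: card_1_singleton_iff)
  then have "card D \<le> 2 * m + max 2 (card K)"
  proof cases
    case 1
    then show ?thesis by (simp add: cardD)
  next
    case (2 h)
    have "card (F h) \<le> Suc m + Suc m"
    proof (rule card_convex_position_le[OF F(2)])
      show "simple_position (F h)"
        using Y F(1)[of h] unfolding simple_position_def by (meson inj_on_subset subsetD)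
      show "convex_position (F h)" unfolding convex_position_def
      proof (intro ballI notI)
        fix p a b c assume abc: "p \<in> F h" "a \<in> F h" "b \<in> F h" "c \<in> F h" "in_triangle p a b c"
        \<comment> \<open>\<open>b\<close> and \<open>c\<close> trade places because
          \<open>blowup\<close> reverses orientation within a cluster.\<close>
        then have "in_triangle (blowup e h p) (blowup e h a) (blowup e h c) (blowup e h b)"
          using \<open>e > 0\<close> orient_swap[of a b p] orient_swap[of b c p] orient_swap[of c a p]
          by (simp add: in_triangle_def orient_blowup_same mult_pos_neg)
        then show False using conv abc by blast
      qed
    qed (use cups caps F(1)[of h] in blast)+
    then show ?thesis using 2 by (simp add: cardD)
  next
    case 3
    then have ne: "K \<noteq> {}" by auto
    have "Min ((\<lambda>p. p$1) ` K) \<in> (\<lambda>p. p$1) ` K" "Max ((\<lambda>p. p$1) ` K) \<in> (\<lambda>p. p$1) ` K"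
      using K(2) ne by (auto intro!: Min_in Max_in simp del: Min_in Max_in)
    then obtain l r where lr: "l \<in> K" "r \<in> K" "l$1 = Min ((\<lambda>p. p$1) ` K)" "r$1 = Max ((\<lambda>p. p$1) ` K)"
      by fastforce
    have bounds: "l$1 \<le> h$1" "h$1 \<le> r$1" if "h \<in> K" for h using lr K(2) that by simp_all
    have "l \<noteq> r"
    proof
      assume "l = r"
      then have "h = l" if "h \<in> K" for h
        using bounds[OF that] that lr(1) inj_onD[OF xinj, of h l] by simp
      then have "K \<subseteq> {l}" by blast
      then have "card K \<le> card {l}" by (intro card_mono) auto
      then show False using 3 by simp
    qed
    then have "l$1 < r$1"
      using bounds[of l] lr inj_onD[OF xinj, of l r] by fastforce
    have "card (F h) \<le> 1" if "h \<in> K - {l} - {r}" for h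
    proof -
      have "h$1 \<noteq> l$1" "h$1 \<noteq> r$1" using inj_onD[OF xinj] that lr by blast+
      then show ?thesis using middle[of l h r] bounds[of h] that lr by auto
    qed
    then have "(\<Sum>h\<in>K - {l} - {r}. card (F h)) \<le> card (K - {l} - {r})"
      using sum_bounded_above[of "K - {l} - {r}" "\<lambda>h. card (F h)" 1] by simp
    moreover have "card D = card (F l) + (card (F r) + (\<Sum>h\<in>K - {l} - {r}. card (F h)))"
      using cardD lr \<open>l \<noteq> r\<close> K(2) by (simp add: sum.remove[of K l] sum.remove[of "K - {l}" r])
    moreover have "card (K - {l} - {r}) = card K - 2" using lr \<open>l \<noteq> r\<close> K(2) by simp
    moreover have "card (F l) \<le> Suc m" "card (F r) \<le> Suc m"
      using left[of l r] right[of r l] lr \<open>l$1 < r$1\<close> by auto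
    ultimately show ?thesis using 3 by linarith
  qed
  then show ?thesis by (simp add: K_def)
qed

lemma blowup_interior_count:
  assumes "thin e H Y" and horton: "horton H" and fin: "finite Y" and Y: "simple_position Y"
    and cups: "\<And>K. K \<subseteq> Y \<Longrightarrow> cup K \<Longrightarrow> card K \<le> Suc m"
    and caps: "\<And>K. K \<subseteq> Y \<Longrightarrow> cap K \<Longrightarrow> card K \<le> Suc m"
    and C: "C \<subseteq> (\<lambda>(h, y). blowup e h y) ` (H \<times> Y)" "convex_ngon (2 * m + 6 + j) C" "j > 0"
  shows "j * card Y \<le> interior_count ((\<lambda>(h, y). blowup e h y) ` (H \<times> Y)) C"
proof -
  let ?q = "\<lambda>(h, y). blowup e h y"
  note thin = assms(1)
  note H = horton_simple_position[OF horton] and finH = horton_finite[OF horton]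
  note inj = thin_inj[OF thin H Y]
  obtain D where D: "D \<subseteq> H \<times> Y" "C = ?q ` D"
    using C(1) unfolding subset_image_iff by blast
  note conv = convex_ngon_imp_convex_position[OF C(2)]
  define K where "K = fst ` D"
  have KH: "K \<subseteq> H" using D(1) by (auto simp: K_def)
  have "card D = card C" using D inj by (simp add: card_image inj_on_subset)
  also have "\<dots> = 2 * m + 6 + j" using C(2) by (simp add: convex_ngon_def)
  finally have "2 * m + 6 + j \<le> 2 * m + max 2 (card K)"
    using card_convex_position_clusters[OF thin finH fin H Y cups caps D(1)] conv D(2)
    by (simp add: K_def)
  \<comment> \<open>As 6 + j exceeds 2, the maximum must be \<open>card K\<close>; a single cluster
    is impossible.\<close>
  then have cardK: "6 + j \<le> card K" by linarith
  define f where "f h = (SOME y. (h, y) \<in> D)" for h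
  have f: "(h, f h) \<in> D" if "h \<in> K" for h
    using that unfolding K_def f_def by (auto intro: someI)
  then have fY: "f h \<in> Y" and fC: "blowup e h (f h) \<in> C" if "h \<in> K" for h
    using that D by force+
  have "convex_position K"
    unfolding convex_position_def
  proof (intro ballI notI)
    fix p a b c assume mem: "p \<in> K" "a \<in> K" "b \<in> K" "c \<in> K" and "in_triangle p a b c"
    then have "in_triangle (blowup e p (f p)) (blowup e a (f a)) (blowup e b (f b)) (blowup e c (f c))"
      using in_triangle_blowup[OF thin] KH fY by blast
    then show False using conv fC mem unfolding convex_position_def by blast
  qed
  define G where "G = {g \<in> H. \<exists>a\<in>K. \<exists>b\<in>K. \<exists>c\<in>K. in_triangle g a b c}"
  have "card K \<le> card G + 6"
    unfolding G_def using horton_convex_position[OF horton KH \<open>convex_position K\<close>] .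
  then have "j * card Y \<le> card G * card Y" using cardK by simp
  also have "\<dots> = card (?q ` (G \<times> Y))"
  proof -
    have "inj_on ?q (G \<times> Y)" by (rule inj_on_subset[OF inj]) (auto simp: G_def)
    then show ?thesis by (simp add: card_image card_cartesian_product)
  qed
  also have "\<dots> \<le> interior_count (?q ` (H \<times> Y)) C"
    unfolding interior_count_def
  proof (rule card_mono)
    show "finite {x \<in> ?q ` (H \<times> Y). x \<in> interior (convex hull C)}" using finH fin by simp
    show "?q ` (G \<times> Y) \<subseteq> {x \<in> ?q ` (H \<times> Y). x \<in> interior (convex hull C)}"
    proof clarify
      fix g y assume g: "g \<in> G" "y \<in> Y"
      then obtain a b c where abc: "g \<in> H" "a \<in> K" "b \<in> K" "c \<in> K" "in_triangle g a b c"
        by (auto simp: G_def)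
      then have "in_triangle (blowup e g y) (blowup e a (f a)) (blowup e b (f b)) (blowup e c (f c))"
        using in_triangle_blowup[OF thin abc(5)] KH fY g by blast
      then have "blowup e g y \<in> interior (convex hull {blowup e a (f a), blowup e b (f b), blowup e c (f c)})"
        by (rule in_triangle_imp_interior)
      also have "\<dots> \<subseteq> interior (convex hull C)"
        using fC abc by (intro interior_mono hull_mono) auto
      finally show "blowup e g y \<in> ?q ` (H \<times> Y) \<and> blowup e g y \<in> interior (convex hull C)"
        using abc g by auto
    qed
  qed
  finally show ?thesis .
qed

text \<open>Here m is (n - 7) / 2 with j = 1, or (n - 8) / 2 with j = 2. The inequality is strict
  because the binomial is positive, so the natural subtraction of 1 in \<open>kval\<close> does not
  truncate.\<close>

lemma kval_less:
  assumes "n \<ge> 7"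
  obtains m j where "n = 2 * m + 6 + j" "j > 0" "kval n < j * ((m + m) choose m)"
proof -
  have pos: "(2 * m choose m) > 0" for m :: nat by (simp add: zero_less_binomial)
  show ?thesis
  proof (cases "odd n")
    case True
    then obtain i where "n = 2 * i + 1" by (elim oddE)
    then have m: "n = 2 * (i - 3) + 6 + 1" using assms by arith
    have "kval n = (2 * (i - 3) choose (i - 3)) - 1" unfolding m by (simp add: kval_def)
    then show ?thesis using pos[of "i - 3"] by (intro that[OF m]) (simp_all add: mult_2)
  next
    case False
    then obtain i where "n = 2 * i" by (auto elim: evenE)
    then have m: "n = 2 * (i - 4) + 6 + 2" using assms by arith
    have "kval n = 2 * (2 * (i - 4) choose (i - 4)) - 1" unfolding m by (simp add: kval_def)
    then show ?thesis using pos[of "i - 4"] by (intro that[OF m]) (simp_all add: mult_2)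
  qed
qed

theorem mainTheorem3:
  fixes n :: nat
  assumes "n \<ge> 7"
  shows "\<forall>N::nat. N > 0 \<longrightarrow> (\<exists>X :: point set. finite X \<and> card X \<ge> N \<and> general_position X \<and>
           (\<forall>C\<subseteq>X. convex_ngon n C \<longrightarrow> interior_count X C > kval n))"
proof (intro allI impI)
  fix N :: nat
  obtain m j where n: "n = 2 * m + 6 + j" "j > 0" and k: "kval n < j * ((m + m) choose m)"
    using kval_less[OF assms] by blast
  obtain H where H: "horton H" "(\<lambda>p. p$1) ` H = real ` {..<2^N}"
    using horton_exists by blast
  obtain Y where Y: "finite Y" "simple_position Y" "card Y = (m + m) choose m"
      "\<And>K. K \<subseteq> Y \<Longrightarrow> cup K \<Longrightarrow> card K \<le> Suc m" "\<And>K. K \<subseteq> Y \<Longrightarrow> cap K \<Longrightarrow> card K \<le> Suc m"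
    using erdos_szekeres_set_exists[of m m] by blast
  have simple: "simple_position H" and fin: "finite H"
    using horton_simple_position horton_finite H(1) by blast+
  obtain e where e: "thin e H Y" using thin_exists[OF fin Y(1)] by blast
  let ?q = "\<lambda>(h, y). blowup e h y"
  let ?X = "?q ` (H \<times> Y)"
  have "card ((\<lambda>p. p$1) ` H) = 2 ^ N" unfolding H(2) by (simp add: card_image)
  then have "2 ^ N \<le> card H" using card_image_le[OF fin, of "\<lambda>p. p$1"] by simp
  moreover have "N \<le> 2 ^ N" by (simp add: less_imp_le)
  ultimately have "N \<le> card H" by linarith
  have "0 < card Y" unfolding Y(3) by (rule zero_less_binomial) simp
  with \<open>N \<le> card H\<close> have "N \<le> card H * card Y" by (cases "card Y") auto
  also have "\<dots> = card ?X"
    using thin_inj[OF e simple Y(2)] by (simp add: card_image card_cartesian_product)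
  finally have "N \<le> card ?X" .
  moreover have "general_position ?X"
    unfolding general_position_def
  proof (intro ballI impI notI)
    fix a b c assume "a \<in> ?X" "b \<in> ?X" "c \<in> ?X" and ne: "a \<noteq> b \<and> a \<noteq> c \<and> b \<noteq> c"
      and col: "collinear {a, b, c}"
    then obtain h y h' y' h'' y'' where mem: "h \<in> H" "h' \<in> H" "h'' \<in> H" "y \<in> Y" "y' \<in> Y" "y'' \<in> Y"
      and abc: "a = blowup e h y" "b = blowup e h' y'" "c = blowup e h'' y''" by auto
    have "orient (blowup e h y) (blowup e h' y') (blowup e h'' y'') \<noteq> 0"
      by (rule thin_orient_nonzero[OF e simple Y(2) mem]) (use ne abc in auto)
    then show False using collinear_imp_orient_0[OF col] abc by simp
  qed
  moreover have "interior_count ?X C > kval n" if "C \<subseteq> ?X" "convex_ngon n C" for C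
  proof -
    have "j * card Y \<le> interior_count ?X C"
      using that n by (intro blowup_interior_count[OF e H(1) Y(1,2,4,5)]) simp_all
    then show ?thesis using k Y(3) by simp
  qed
  ultimately show "\<exists>X :: point set. finite X \<and> card X \<ge> N \<and> general_position X \<and>
           (\<forall>C\<subseteq>X. convex_ngon n C \<longrightarrow> interior_count X C > kval n)"
    using fin Y(1) by (intro exI[of _ ?X] conjI allI impI finite_imageI finite_cartesian_product)
qed

end
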